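(* Let $x_1,\dots,x_n$ be arbitrary vectors in $\mathbb{R}^p$, let $\epsilon>0$, and let $A\in\mathbb{R}^{d\times p}$ be a random matrix with independent entries $$A_{ik}=\frac{1}{\sqrt{dq}}\,\zeta_{ik}U_{ik},$$ where $U$ and $\zeta$ are as described in the context and $$q\ \geq\ \max_{i\neq j}\frac{\|x_i-x_j\|_\infty^2}{\|x_i-x_j\|_2^2}.$$ Then for any $\delta\in(0,1)$ and any $d$ such that $$d\ \geq\ \frac{12}{\epsilon^2}\,\log(3n/\delta)\left(1+\sqrt{4\log(nd/\delta)}+2\log(nd/\delta)\right)^2,$$ the following property holds with probability at least $1-\delta$: $$\forall\, 1\le i,j\le n,\qquad (1-\epsilon)\,\|Ax_i-Ax_j\|^2\ \le\ \|x_i-x_j\|^2\ \le\ (1+\epsilon)\,\|Ax_i-Ax_j\|^2 .$$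
   Context: $U=(U_{ik})\in\mathbb{R}^{d\times p}$ is a random matrix with i.i.d. $1$-sub-Gaussian entries of variance $1$, and $\zeta=(\zeta_{ik})\in\mathbb{R}^{d\times p}$ is a random matrix with i.i.d. Bernoulli entries of parameter $q$, independent of $U$. A real random variable $X$ is called $1$-sub-Gaussian if $\mathbb{E}[e^{\lambda X}]\le e^{\lambda^2/2}$ for all $\lambda\in\mathbb{R}$. For a vector $v$, $\|v\|=\|v\|_2$ is the Euclidean norm and $\|v\|_\infty=\max_k|v_k|$. $\log$ is the natural logarithm.
   Formalization: The formal theorem assumes 0 < ε < 1 instead of ε > 0; for large ε the claim is false (e.g. p=2, d=1, n=2, x_1=(1,1), x_2=0, Rademacher U, q=1, δ=1/4, ε=50, where A(x_1−x_2)=0 with probability 1/2). *)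

theory Defs
  imports "HOL-Probability.Probability"
begin

text \<open>The integrability conjunct is needed because the Bochner integral of a non-integrable
  function is \<open>0\<close>, which would make the bound on the moment generating function hold vacuously.\<close>

definition sub_gaussian1 :: "'a measure \<Rightarrow> ('a \<Rightarrow> real) \<Rightarrow> bool" where
  "sub_gaussian1 M X \<longleftrightarrow> X \<in> borel_measurable M \<and>
     (\<forall>l::real. integrable M (\<lambda>\<omega>. exp (l * X \<omega>)) \<and>
        (\<integral>\<omega>. exp (l * X \<omega>) \<partial>M) \<le> exp (l\<^sup>2 / 2))"

definition bernoulli_rv :: "'a measure \<Rightarrow> real \<Rightarrow> ('a \<Rightarrow> real) \<Rightarrow> bool" where
  "bernoulli_rv M q X \<longleftrightarrow> q \<in> {0..1} \<and> X \<in> borel_measurable M \<and>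
     distr M borel X = distr (measure_pmf (bernoulli_pmf q)) borel of_bool"

text \<open>A \<open>d \<times> p\<close> matrix has type \<open>real ^ 'p ^ 'd\<close>: the row index comes first in \<open>X \<omega> $ i $ k\<close>.\<close>

definition iid_entries :: "'a measure \<Rightarrow> ('a \<Rightarrow> real ^ 'p ^ 'd) \<Rightarrow> bool" where
  "iid_entries M X \<longleftrightarrow>
     prob_space.indep_vars M (\<lambda>_. borel) (\<lambda>(i, k) \<omega>. X \<omega> $ i $ k) UNIV \<and>
     (\<forall>i k i' k'. distr M borel (\<lambda>\<omega>. X \<omega> $ i $ k) = distr M borel (\<lambda>\<omega>. X \<omega> $ i' $ k'))"

end

theory Submission
  imports Defs
begin

text \<open>Fix \<open>v = x i - x j \<noteq> 0\<close> and put \<open>c = v / (sqrt q * norm v)\<close>. Then \<open>(norm (A v))\<^sup>2 / (norm v)\<^sup>2\<close> is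
  the average over the \<open>d\<close> rows of \<open>Y\<^sup>2\<close>, where \<open>Y = (\<Sum>k. \<zeta>\<^sub>k c\<^sub>k U\<^sub>k)\<close>. Given \<open>\<zeta>\<close>, the variable \<open>Y\<close> is sub-Gaussian
  with variance proxy equal to its variance \<open>T = (\<Sum>k. (\<zeta>\<^sub>k c\<^sub>k)\<^sup>2)\<close>, which gives
  \<open>E[exp (\<eta> Y\<^sup>2) | \<zeta>] \<le> 1 + \<eta> T + 2 \<eta>\<^sup>2 T\<^sup>2\<close> whenever \<open>\<eta> T \<le> 1/8\<close>. The lower bound on \<open>q\<close> says that the
  summands of \<open>T\<close> lie in \<open>[0, 1]\<close>; hence \<open>E T = 1\<close>, \<open>E T\<^sup>2 \<le> 2\<close> and \<open>E (exp T) \<le> exp 2\<close>. Truncating at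
  \<open>T \<le> B\<close>, where \<open>B = 1 + sqrt (4 L) + 2 L\<close> and \<open>L = ln (n d / \<delta>)\<close>, costs at most \<open>d exp (2 - B)\<close> in
  probability, and Chernoff's method with \<open>\<eta> = \<epsilon> / (8 B)\<close> for the upper tail and \<open>\<eta> = - \<epsilon> / 16\<close> for the
  lower tail bounds the rest. The total is at most \<open>\<delta> / n\<^sup>2\<close> per pair.\<close>

subsection \<open>Real inequalities and Gaussian integrals\<close>

text \<open>The even power series of \<open>cosh\<close> has nonnegative terms, so cutting it off
  gives a lower bound. The quartic term is what yields control of the fourth moment.\<close>

lemma cosh_ge_fourth_order: "1 + x\<^sup>2 / 2 + x ^ 4 / 24 \<le> cosh (x::real)"
proof -
  let ?f = "\<lambda>n. if even n then x ^ n /\<^sub>R fact n else 0"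
  have "sum ?f {..<5} \<le> suminf ?f"
    using cosh_converges[of x]
    by (intro sum_le_suminf) (auto simp: sums_iff zero_le_even_power)
  also have "suminf ?f = cosh x"
    using cosh_converges[of x] by (simp add: sums_iff)
  also have "sum ?f {..<5} = 1 + x\<^sup>2 / 2 + x ^ 4 / 24"
  proof -
    have "{..<5} = {0, 1, 2, 3, 4 :: nat}" by auto
    then show ?thesis by (simp add: fact_numeral)
  qed
  finally show ?thesis .
qed

lemma power_le_fact_mult_exp:
  assumes "0 \<le> (x::real)"
  shows "x ^ n \<le> fact n * exp x"
proof -
  let ?f = "\<lambda>n. x ^ n /\<^sub>R fact n"
  have "sum ?f {n} \<le> suminf ?f"
    using assms by (intro sum_le_suminf summable_exp_generic) auto
  then show ?thesis
    by (simp add: exp_def field_simps)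
qed

text \<open>Squaring reduces the claim to
  \<open>(1 + y + 2 * y\<^sup>2)\<^sup>2 * (1 - 2 * y) \<ge> 1\<close>, where the terms of order
  zero and one cancel and a factor \<open>y\<^sup>2\<close> remains.\<close>

lemma inverse_sqrt_le_quadratic:
  fixes y :: real
  assumes "0 \<le> y" "y \<le> 1 / 8"
  shows "1 / sqrt (1 - 2 * y) \<le> 1 + y + 2 * y\<^sup>2"
proof -
  \<comment> \<open>The left side is increasing in \<open>y\<close>, and its value at 1/8 is 53/64 <
    1.\<close>
  have "6 * y + 4 * y\<^sup>2 + 8 * y ^ 3 \<le> 6 * (1/8) + 4 * (1/8)\<^sup>2 + 8 * (1/8) ^ 3"
    using assms by (intro add_mono mult_left_mono power_mono) auto
  then have "0 \<le> 1 - 6 * y - 4 * y\<^sup>2 - 8 * y ^ 3"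
    by (simp add: power2_eq_square power3_eq_cube)
  then have "0 \<le> y\<^sup>2 * (1 - 6 * y - 4 * y\<^sup>2 - 8 * y ^ 3)"
    by simp
  also have "\<dots> = (1 + y + 2 * y\<^sup>2)\<^sup>2 * (1 - 2 * y) - 1"
    by algebra
  finally have "sqrt 1 \<le> sqrt ((1 + y + 2 * y\<^sup>2)\<^sup>2 * (1 - 2 * y))"
    by (intro real_sqrt_le_mono) simp
  then have "1 \<le> (1 + y + 2 * y\<^sup>2) * sqrt (1 - 2 * y)"
    using assms by (simp add: real_sqrt_mult)
  then show ?thesis
    using assms by (simp add: divide_simps)
qed

text \<open>The factor \<open>exp (a * g\<^sup>2)\<close> only rescales the density: the integrand
  is \<open>s\<close> times the centred normal density of standard deviation
  \<open>s = 1 / sqrt (1 - 2 * a)\<close>.\<close>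

lemma nn_integral_gaussian:
  assumes "(a::real) < 1 / 2"
  shows "(\<integral>\<^sup>+g. ennreal (std_normal_density g * exp (a * g\<^sup>2)) \<partial>lborel)
    = ennreal (1 / sqrt (1 - 2 * a))"
proof -
  define s where "s = 1 / sqrt (1 - 2 * a)"
  have s: "s > 0" "s\<^sup>2 = 1 / (1 - 2 * a)"
    using assms by (simp_all add: s_def power_divide)
  have "std_normal_density g * exp (a * g\<^sup>2) = s * normal_density 0 s g" for g
  proof -
    have "exp (- g\<^sup>2 / 2) * exp (a * g\<^sup>2) = exp (- g\<^sup>2 / (2 * s\<^sup>2))"
      unfolding s mult_exp_exp by (simp add: field_simps)
    moreover have "sqrt (2 * pi * s\<^sup>2) = sqrt (2 * pi) * s"
      using s(1) by (simp add: real_sqrt_mult)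
    ultimately show ?thesis
      using s(1) by (simp add: normal_density_def)
  qed
  then have "(\<integral>\<^sup>+g. ennreal (std_normal_density g * exp (a * g\<^sup>2)) \<partial>lborel)
    = (\<integral>\<^sup>+g. ennreal s * ennreal (normal_density 0 s g) \<partial>lborel)"
    using s(1) by (intro nn_integral_cong) (simp add: ennreal_mult')
  also have "\<dots> = ennreal s * (\<integral>\<^sup>+g. ennreal (normal_density 0 s g) \<partial>lborel)"
    by (rule nn_integral_cmult) simp
  also have "(\<integral>\<^sup>+g. ennreal (normal_density 0 s g) \<partial>lborel) = 1"
    using s(1) by (subst nn_integral_eq_integral) auto
  finally show ?thesis
    by (simp add: s_def)
qed

text \<open>Completing the square turns the integrand into \<open>exp (t\<^sup>2 / 2)\<close> times
  the normal density with mean \<open>t\<close>.\<close>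

lemma gaussian_mgf:
  "(\<integral>\<^sup>+g. ennreal (std_normal_density g * exp (t * g)) \<partial>lborel) = ennreal (exp (t\<^sup>2 / 2))"
proof -
  have "std_normal_density g * exp (t * g) = exp (t\<^sup>2 / 2) * normal_density t 1 g" for g
  proof -
    have "exp (- g\<^sup>2 / 2) * exp (t * g) = exp (t\<^sup>2 / 2) * exp (- (g - t)\<^sup>2 / 2)"
      unfolding mult_exp_exp by (simp add: power2_eq_square field_simps)
    then show ?thesis by (simp add: normal_density_def)
  qed
  then have "(\<integral>\<^sup>+g. ennreal (std_normal_density g * exp (t * g)) \<partial>lborel)
    = (\<integral>\<^sup>+g. ennreal (exp (t\<^sup>2 / 2)) * ennreal (normal_density t 1 g) \<partial>lborel)"
    by (intro nn_integral_cong) (simp add: ennreal_mult')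
  also have "\<dots> = ennreal (exp (t\<^sup>2 / 2)) * (\<integral>\<^sup>+g. ennreal (normal_density t 1 g) \<partial>lborel)"
    by (rule nn_integral_cmult) simp
  also have "(\<integral>\<^sup>+g. ennreal (normal_density t 1 g) \<partial>lborel) = 1"
    by (subst nn_integral_eq_integral) auto
  finally show ?thesis by simp
qed

subsection \<open>Sub-Gaussian variables\<close>

text \<open>The parameter \<open>s\<close> is the variance proxy, i.e. the square of the scale. It
  is kept variable because linear combinations change it, and the value 0 is allowed since a row of
  \<zeta> may vanish.\<close>

definition sub_gaussian :: "'a measure \<Rightarrow> real \<Rightarrow> ('a \<Rightarrow> real) \<Rightarrow> bool" where
  "sub_gaussian M s X \<longleftrightarrow> X \<in> borel_measurable M \<and>
     (\<forall>l. integrable M (\<lambda>\<omega>. exp (l * X \<omega>)) \<and>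
        (\<integral>\<omega>. exp (l * X \<omega>) \<partial>M) \<le> exp (l\<^sup>2 * s / 2))"

lemma sub_gaussian1_iff: "sub_gaussian1 M X \<longleftrightarrow> sub_gaussian M 1 X"
  by (simp add: sub_gaussian1_def sub_gaussian_def)

text \<open>Both exponentials \<open>exp X\<close> and \<open>exp (- X)\<close> are integrable, and
  their sum dominates every power of \<open>\<bar>X\<bar>\<close> up to a factorial.\<close>

lemma sub_gaussian_integrable_power:
  assumes "sub_gaussian M s X"
  shows "integrable M (\<lambda>\<omega>. X \<omega> ^ n)"
proof (rule Bochner_Integration.integrable_bound)
  show "integrable M (\<lambda>\<omega>. fact n * (exp (1 * X \<omega>) + exp ((-1) * X \<omega>)))"
    using assms unfolding sub_gaussian_def by (intro integrable_mult_right Bochner_Integration.integrable_add) blast+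
  show "(\<lambda>\<omega>. X \<omega> ^ n) \<in> borel_measurable M"
    using assms unfolding sub_gaussian_def by (intro borel_measurable_power) blast
  have "\<bar>y\<bar> ^ n \<le> fact n * (exp y + exp (- y))" for y :: real
  proof -
    have "exp \<bar>y\<bar> \<le> exp y + exp (- y)"
      by (cases "y \<ge> 0") auto
    then have "fact n * exp \<bar>y\<bar> \<le> fact n * (exp y + exp (- y))"
      by (intro mult_left_mono) auto
    with power_le_fact_mult_exp[of "\<bar>y\<bar>" n] show ?thesis by linarith
  qed
  then show "AE \<omega> in M. norm (X \<omega> ^ n) \<le> norm (fact n * (exp (1 * X \<omega>) + exp ((-1) * X \<omega>)))"
    by (auto simp: abs_mult power_abs intro!: AE_I2 order_trans[OF _ abs_ge_self])
qed

context prob_space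
begin

text \<open>From 1 + y \<le> exp y, the function of \<open>l\<close> in \<open>deriv\<close> is
  nonnegative and vanishes at 0. So 0 is a minimum, and the derivative there, minus the mean, must
  be 0.\<close>

lemma sub_gaussian_expectation:
  assumes "sub_gaussian M s X"
  shows "expectation X = 0"
proof -
  have int: "integrable M X"
    using sub_gaussian_integrable_power[OF assms, of 1] by simp
  have le: "l * expectation X \<le> exp (l\<^sup>2 * s / 2) - 1" for l
  proof -
    have "expectation (\<lambda>\<omega>. 1 + l * X \<omega>) \<le> expectation (\<lambda>\<omega>. exp (l * X \<omega>))"
      using assms int by (intro integral_mono) (auto simp: sub_gaussian_def)
    also have "\<dots> \<le> exp (l\<^sup>2 * s / 2)"
      using assms by (auto simp: sub_gaussian_def)
    finally show ?thesis
      using int by (simp add: prob_space)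
  qed
  have deriv: "((\<lambda>l. exp (l\<^sup>2 * s / 2) - 1 - l * expectation X) has_real_derivative - expectation X) (at 0)"
    by (auto intro!: derivative_eq_intros)
  have "- expectation X = 0"
    using le by (intro DERIV_local_min[OF deriv, of 1]) auto
  then show ?thesis by simp
qed

text \<open>Averaging the generating function at \<open>l\<close> and \<open>- l\<close> gives the
  expectation of a \<open>cosh\<close>. Because the second moment equals the proxy, the quadratic
  terms on both sides cancel and the quartic one is bounded by the remainder of
  \<open>exp (l\<^sup>2 * s / 2)\<close>.\<close>

lemma sub_gaussian_fourth_moment:
  assumes "sub_gaussian M s X" "expectation (\<lambda>\<omega>. (X \<omega>)\<^sup>2) = s"
  shows "expectation (\<lambda>\<omega>. X \<omega> ^ 4) \<le> 4 * s\<^sup>2"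
proof -
  note int = sub_gaussian_integrable_power[OF assms(1)]
  have mgf: "integrable M (\<lambda>\<omega>. exp (l * X \<omega>))" "expectation (\<lambda>\<omega>. exp (l * X \<omega>)) \<le> exp (l\<^sup>2 * s / 2)" for l
    using assms(1) by (auto simp: sub_gaussian_def)
  have key: "l ^ 4 * expectation (\<lambda>\<omega>. X \<omega> ^ 4) / 24 \<le> exp (l\<^sup>2 * s / 2) - 1 - l\<^sup>2 * s / 2" for l
  proof -
    have "1 + l\<^sup>2 * s / 2 + l ^ 4 * expectation (\<lambda>\<omega>. X \<omega> ^ 4) / 24
        = expectation (\<lambda>\<omega>. 1 + l\<^sup>2 / 2 * (X \<omega>)\<^sup>2 + l ^ 4 / 24 * X \<omega> ^ 4)"
      using int assms(2) by (simp add: prob_space)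
    also have "\<dots> \<le> expectation (\<lambda>\<omega>. (exp (l * X \<omega>) + exp ((- l) * X \<omega>)) / 2)"
    proof (rule integral_mono)
      show "1 + l\<^sup>2 / 2 * (X \<omega>)\<^sup>2 + l ^ 4 / 24 * X \<omega> ^ 4 \<le> (exp (l * X \<omega>) + exp ((- l) * X \<omega>)) / 2" for \<omega>
        using cosh_ge_fourth_order[of "l * X \<omega>"] by (simp add: cosh_def power_mult_distrib)
    next
      show "integrable M (\<lambda>\<omega>. (exp (l * X \<omega>) + exp ((- l) * X \<omega>)) / 2)"
        using mgf(1) by (intro integrable_divide_zero Bochner_Integration.integrable_add) blast+
    qed (use int in auto)
    also have "\<dots> = (expectation (\<lambda>\<omega>. exp (l * X \<omega>)) + expectation (\<lambda>\<omega>. exp ((- l) * X \<omega>))) / 2"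
      using mgf(1)[of l] mgf(1)[of "- l"] by simp
    also have "\<dots> \<le> exp (l\<^sup>2 * s / 2)"
      using mgf(2)[of l] mgf(2)[of "- l"] by simp
    finally show ?thesis by linarith
  qed
  have "s \<ge> 0"
    unfolding assms(2)[symmetric] by simp
  show ?thesis
  proof (cases "s = 0")
    case True
    then show ?thesis using key[of 1] by simp
  next
    case False
    with \<open>s \<ge> 0\<close> have s: "s > 0" by simp
    \<comment> \<open>With l = 1 / sqrt s the bound is 24 s^2 (exp (1/2) - 3/2). The estimate exp
      (1/2) \<le> 5/3 makes the factor exactly 24 (5/3 - 3/2) = 4.\<close>
    have "(exp (1 / 2 :: real))\<^sup>2 = exp 1"
      by (simp add: power2_eq_square mult_exp_exp)
    also have "\<dots> \<le> (5 / 3)\<^sup>2"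
      using e_less_272 by (simp add: power2_eq_square)
    finally have half: "exp (1 / 2 :: real) \<le> 5 / 3"
      by (rule power2_le_imp_le) simp
    have le_4: "y / 24 \<le> e - 1 - 1 / 2 \<Longrightarrow> e \<le> 5 / 3 \<Longrightarrow> y \<le> 4" for y e :: real
      by simp
    have "(1 / sqrt s) ^ 4 = ((1 / sqrt s)\<^sup>2)\<^sup>2"
      by simp
    also have "\<dots> = 1 / s\<^sup>2"
      using s by (simp add: power_divide)
    finally have "1 / s\<^sup>2 * expectation (\<lambda>\<omega>. X \<omega> ^ 4) / 24 \<le> exp (1 / 2) - 1 - 1 / 2"
      using key[of "1 / sqrt s"] s by (simp add: power_divide)
    then have "1 / s\<^sup>2 * expectation (\<lambda>\<omega>. X \<omega> ^ 4) \<le> 4"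
      using half le_4[of "1 / s\<^sup>2 * expectation (\<lambda>\<omega>. X \<omega> ^ 4)"] by blast
    then show ?thesis
      using s by (simp add: field_simps)
  qed
qed

text \<open>Gaussian linearisation: averaging \<open>exp (sqrt (2 * \<eta>) * g * X)\<close> over a standard normal \<open>g\<close>
  gives \<open>exp (\<eta> * X\<^sup>2)\<close>.\<close>

lemma sub_gaussian_exp_square:
  assumes X: "sub_gaussian M s X" and "0 \<le> \<eta>" "2 * \<eta> * s < 1"
  shows "(\<integral>\<^sup>+\<omega>. ennreal (exp (\<eta> * (X \<omega>)\<^sup>2)) \<partial>M) \<le> ennreal (1 / sqrt (1 - 2 * (\<eta> * s)))"
proof -
  have [measurable]: "X \<in> borel_measurable M"
    using X by (simp add: sub_gaussian_def)
  interpret L: pair_sigma_finite M lborel ..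
  define t where "t = sqrt (2 * \<eta>)"
  have t: "t\<^sup>2 = 2 * \<eta>" using assms by (simp add: t_def)
  have "(\<integral>\<^sup>+\<omega>. ennreal (exp (\<eta> * (X \<omega>)\<^sup>2)) \<partial>M)
      = (\<integral>\<^sup>+\<omega>. \<integral>\<^sup>+g. ennreal (std_normal_density g * exp (t * X \<omega> * g)) \<partial>lborel \<partial>M)"
    unfolding gaussian_mgf using t by (simp add: power_mult_distrib)
  also have "\<dots> = (\<integral>\<^sup>+g. \<integral>\<^sup>+\<omega>. ennreal (std_normal_density g * exp (t * X \<omega> * g)) \<partial>M \<partial>lborel)"
    by (rule L.Fubini'[symmetric]) measurable
  \<comment> \<open>For fixed \<open>g\<close> the sub-Gaussian bound is applied at
    \<open>l = t * g\<close>, where \<open>(t * g)\<^sup>2 * s / 2 = \<eta> * s * g\<^sup>2\<close>.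
    The remaining Gaussian integral is finite because \<open>2 * \<eta> * s < 1\<close>.\<close>
  also have "\<dots> \<le> (\<integral>\<^sup>+g. ennreal (std_normal_density g * exp ((\<eta> * s) * g\<^sup>2)) \<partial>lborel)"
  proof (rule nn_integral_mono)
    fix g :: real
    have int: "integrable M (\<lambda>\<omega>. exp ((t * g) * X \<omega>))"
      and le: "expectation (\<lambda>\<omega>. exp ((t * g) * X \<omega>)) \<le> exp ((t * g)\<^sup>2 * s / 2)"
      using X unfolding sub_gaussian_def by blast+
    have "(\<integral>\<^sup>+\<omega>. ennreal (std_normal_density g * exp (t * X \<omega> * g)) \<partial>M)
        = ennreal (std_normal_density g) * (\<integral>\<^sup>+\<omega>. ennreal (exp ((t * g) * X \<omega>)) \<partial>M)"
      by (subst nn_integral_cmult[symmetric]) (auto simp: ennreal_mult' ac_simps)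
    also have "(\<integral>\<^sup>+\<omega>. ennreal (exp ((t * g) * X \<omega>)) \<partial>M) = ennreal (expectation (\<lambda>\<omega>. exp ((t * g) * X \<omega>)))"
      using int by (intro nn_integral_eq_integral) auto
    also have "ennreal (std_normal_density g) * \<dots> \<le> ennreal (std_normal_density g) * ennreal (exp ((t * g)\<^sup>2 * s / 2))"
      using le by (intro mult_left_mono ennreal_leI) auto
    also have "\<dots> = ennreal (std_normal_density g * exp ((\<eta> * s) * g\<^sup>2))"
      using t by (simp add: ennreal_mult' power_mult_distrib ac_simps)
    finally show "(\<integral>\<^sup>+\<omega>. ennreal (std_normal_density g * exp (t * X \<omega> * g)) \<partial>M)
      \<le> ennreal (std_normal_density g * exp ((\<eta> * s) * g\<^sup>2))" .
  qed
  also have "\<dots> = ennreal (1 / sqrt (1 - 2 * (\<eta> * s)))"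
    using assms by (intro nn_integral_gaussian) simp
  finally show ?thesis .
qed

text \<open>One quadratic bound serves both tails. For nonnegative \<eta> it comes from the Gaussian
  linearisation; for negative \<eta> from a second-order bound on the exponential, where the
  fourth-moment constant 4 gives the same coefficient 4/2 = 2.\<close>

lemma sub_gaussian_exp_square_le_quadratic:
  assumes X: "sub_gaussian M s X" and sq: "expectation (\<lambda>\<omega>. (X \<omega>)\<^sup>2) = s"
    and \<eta>: "\<eta> * s \<le> 1 / 8"
  shows "(\<integral>\<^sup>+\<omega>. ennreal (exp (\<eta> * (X \<omega>)\<^sup>2)) \<partial>M) \<le> ennreal (1 + \<eta> * s + 2 * \<eta>\<^sup>2 * s\<^sup>2)"
proof (cases "\<eta> \<ge> 0")
  case True
  have "s \<ge> 0" unfolding sq[symmetric] by simp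
  have "(\<integral>\<^sup>+\<omega>. ennreal (exp (\<eta> * (X \<omega>)\<^sup>2)) \<partial>M) \<le> ennreal (1 / sqrt (1 - 2 * (\<eta> * s)))"
    using True \<eta> by (intro sub_gaussian_exp_square[OF X]) auto
  also have "\<dots> \<le> ennreal (1 + \<eta> * s + 2 * (\<eta> * s)\<^sup>2)"
    using True \<eta> \<open>s \<ge> 0\<close> by (intro ennreal_leI inverse_sqrt_le_quadratic) auto
  finally show ?thesis by (simp add: power_mult_distrib mult.assoc)
next
  case False
  note int = sub_gaussian_integrable_power[OF X]
  have [measurable]: "X \<in> borel_measurable M"
    using X by (simp add: sub_gaussian_def)
  have exp_le: "exp (- y) \<le> 1 - y + y\<^sup>2 / 2" if "y \<ge> 0" for y :: real
  proof -
    have "1 + y + y\<^sup>2 / 2 \<le> exp y"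
      using exp_lower_Taylor_quadratic[OF that] .
    then have "1 / exp y \<le> 1 / (1 + y + y\<^sup>2 / 2)"
      using that by (intro divide_left_mono) (auto intro!: mult_pos_pos add_pos_nonneg)
    also have "\<dots> \<le> 1 - y + y\<^sup>2 / 2"
    \<comment> \<open>The product of the two quadratics is (1 + y^2/2)^2 - y^2 = 1 + y^4/4, hence at
      least 1.\<close>
    proof -
      have "(1 - y + y\<^sup>2 / 2) * (1 + y + y\<^sup>2 / 2) = 1 + y ^ 4 / 4"
        by (simp add: power2_eq_square field_simps eval_nat_numeral)
      then have "1 \<le> (1 - y + y\<^sup>2 / 2) * (1 + y + y\<^sup>2 / 2)" by simp
      moreover have "1 + y + y\<^sup>2 / 2 > 0" using that by (intro add_pos_nonneg) auto
      ultimately show ?thesis by (simp add: divide_le_eq)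
    qed
    finally show ?thesis by (simp add: exp_minus inverse_eq_divide)
  qed
  have "(\<integral>\<^sup>+\<omega>. ennreal (exp (\<eta> * (X \<omega>)\<^sup>2)) \<partial>M)
      \<le> (\<integral>\<^sup>+\<omega>. ennreal (1 + \<eta> * (X \<omega>)\<^sup>2 + \<eta>\<^sup>2 / 2 * X \<omega> ^ 4) \<partial>M)"
  proof (intro nn_integral_mono ennreal_leI)
    fix \<omega>
    show "exp (\<eta> * (X \<omega>)\<^sup>2) \<le> 1 + \<eta> * (X \<omega>)\<^sup>2 + \<eta>\<^sup>2 / 2 * X \<omega> ^ 4"
      using exp_le[of "- \<eta> * (X \<omega>)\<^sup>2"] False by (simp add: power_mult_distrib mult_nonpos_nonneg flip: power_mult)
  qed
  also have "\<dots> = ennreal (expectation (\<lambda>\<omega>. 1 + \<eta> * (X \<omega>)\<^sup>2 + \<eta>\<^sup>2 / 2 * X \<omega> ^ 4))"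
  proof (rule nn_integral_eq_integral)
    \<comment> \<open>\<open>ennreal\<close> cuts negative values off at 0, so the integrand must be
      seen to be nonnegative; it is a sum of two squares.\<close>
    have "0 \<le> 1 + \<eta> * y\<^sup>2 + \<eta>\<^sup>2 / 2 * y ^ 4" for y :: real
    proof -
      have "1 + \<eta> * y\<^sup>2 + \<eta>\<^sup>2 / 2 * y ^ 4 = (1 + \<eta> * y\<^sup>2 / 2)\<^sup>2 + (\<eta> * y\<^sup>2)\<^sup>2 / 4"
        by (simp add: power2_eq_square field_simps eval_nat_numeral)
      then show ?thesis by simp
    qed
    then show "AE \<omega> in M. 0 \<le> 1 + \<eta> * (X \<omega>)\<^sup>2 + \<eta>\<^sup>2 / 2 * X \<omega> ^ 4"
      by simp
  qed (use int in auto)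
  also have "expectation (\<lambda>\<omega>. 1 + \<eta> * (X \<omega>)\<^sup>2 + \<eta>\<^sup>2 / 2 * X \<omega> ^ 4)
      = 1 + \<eta> * s + \<eta>\<^sup>2 / 2 * expectation (\<lambda>\<omega>. X \<omega> ^ 4)"
    using int sq by (simp add: prob_space)
  also have "ennreal \<dots> \<le> ennreal (1 + \<eta> * s + \<eta>\<^sup>2 / 2 * (4 * s\<^sup>2))"
    using sub_gaussian_fourth_moment[OF X sq]
    by (intro ennreal_leI add_left_mono mult_left_mono) auto
  finally show ?thesis by (simp add: mult.assoc)
qed

subsection \<open>Independence\<close>

text \<open>This is additivity of the variance, in a form that also covers nonzero means. In the
  induction step the cross term factorises by independence of the new summand from the old
  sum.\<close>

lemma indep_vars_sum_second_moment:
  fixes X :: "'i \<Rightarrow> 'a \<Rightarrow> real"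
  assumes "finite I" "indep_vars (\<lambda>_. borel) X I"
    and "\<And>i. i \<in> I \<Longrightarrow> integrable M (X i)" "\<And>i. i \<in> I \<Longrightarrow> integrable M (\<lambda>\<omega>. (X i \<omega>)\<^sup>2)"
  shows "integrable M (\<lambda>\<omega>. (\<Sum>i\<in>I. X i \<omega>)\<^sup>2)"
    and "expectation (\<lambda>\<omega>. (\<Sum>i\<in>I. X i \<omega>)\<^sup>2)
      = (\<Sum>i\<in>I. expectation (X i))\<^sup>2 + (\<Sum>i\<in>I. expectation (\<lambda>\<omega>. (X i \<omega>)\<^sup>2) - (expectation (X i))\<^sup>2)"
  using assms
proof (induction I rule: finite_induct)
  case empty
  case 1 then show ?case by simp
  case 2 then show ?case by simp
next
  case (insert i I)
  let ?S = "\<lambda>\<omega>. \<Sum>j\<in>I. X j \<omega>"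
  have indep: "indep_vars (\<lambda>_. borel) X I" if "indep_vars (\<lambda>_. borel) X (insert i I)"
    using that by (rule indep_vars_subset) auto
  have exp: "(\<Sum>j\<in>insert i I. X j \<omega>)\<^sup>2 = (X i \<omega>)\<^sup>2 + 2 * (X i \<omega> * ?S \<omega>) + (?S \<omega>)\<^sup>2" for \<omega>
    using insert.hyps by (simp add: power2_sum algebra_simps)
  {
    assume prems: "indep_vars (\<lambda>_. borel) X (insert i I)"
      "\<And>j. j \<in> insert i I \<Longrightarrow> integrable M (X j)"
      "\<And>j. j \<in> insert i I \<Longrightarrow> integrable M (\<lambda>\<omega>. (X j \<omega>)\<^sup>2)"
    have S: "integrable M ?S"
      using prems(2) by simp
    have ind: "indep_var borel (X i) borel ?S"
      using insert.hyps prems(1) by (rule indep_vars_sum)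
    have mult: "integrable M (\<lambda>\<omega>. X i \<omega> * ?S \<omega>)"
      "expectation (\<lambda>\<omega>. X i \<omega> * ?S \<omega>) = expectation (X i) * expectation ?S"
      using indep_var_integrable[OF ind _ S] indep_var_lebesgue_integral[OF ind _ S] prems(2) by auto
    have IH: "integrable M (\<lambda>\<omega>. (?S \<omega>)\<^sup>2)"
      "expectation (\<lambda>\<omega>. (?S \<omega>)\<^sup>2)
      = (\<Sum>i\<in>I. expectation (X i))\<^sup>2 + (\<Sum>i\<in>I. expectation (\<lambda>\<omega>. (X i \<omega>)\<^sup>2) - (expectation (X i))\<^sup>2)"
      using insert.IH indep[OF prems(1)] prems(2,3) by auto
    have "integrable M (\<lambda>\<omega>. (\<Sum>j\<in>insert i I. X j \<omega>)\<^sup>2)"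
      unfolding exp using mult(1) IH(1) prems(3) by auto
    moreover have "expectation (\<lambda>\<omega>. (\<Sum>j\<in>insert i I. X j \<omega>)\<^sup>2)
      = (\<Sum>j\<in>insert i I. expectation (X j))\<^sup>2
        + (\<Sum>j\<in>insert i I. expectation (\<lambda>\<omega>. (X j \<omega>)\<^sup>2) - (expectation (X j))\<^sup>2)"
      unfolding exp using mult IH prems(2,3) insert.hyps
      by (simp add: power2_sum algebra_simps)
    ultimately have "integrable M (\<lambda>\<omega>. (\<Sum>j\<in>insert i I. X j \<omega>)\<^sup>2) \<and> expectation (\<lambda>\<omega>. (\<Sum>j\<in>insert i I. X j \<omega>)\<^sup>2)
      = (\<Sum>j\<in>insert i I. expectation (X j))\<^sup>2
        + (\<Sum>j\<in>insert i I. expectation (\<lambda>\<omega>. (X j \<omega>)\<^sup>2) - (expectation (X j))\<^sup>2)" by blast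
  }
  note * = this
  case 1 then show ?case using * by blast
  case 2 then show ?case using * by blast
qed

text \<open>The generating function of an independent sum factorises, so the variance proxies add
  up.\<close>

lemma sub_gaussian_linear_combination:
  fixes X :: "'i \<Rightarrow> 'a \<Rightarrow> real"
  assumes fin: "finite I" and ind: "indep_vars (\<lambda>_. borel) X I"
    and X: "\<And>i. i \<in> I \<Longrightarrow> sub_gaussian M 1 (X i)"
  shows "sub_gaussian M (\<Sum>i\<in>I. (a i)\<^sup>2) (\<lambda>\<omega>. \<Sum>i\<in>I. a i * X i \<omega>)"
  unfolding sub_gaussian_def
proof (intro conjI allI)
  show "(\<lambda>\<omega>. \<Sum>i\<in>I. a i * X i \<omega>) \<in> borel_measurable M"
    using X by (intro borel_measurable_sum borel_measurable_times) (auto simp: sub_gaussian_def)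
next
  fix l :: real
  have eq: "exp (l * (\<Sum>i\<in>I. a i * X i \<omega>)) = (\<Prod>i\<in>I. exp ((l * a i) * X i \<omega>))" for \<omega>
    using fin by (simp add: exp_sum sum_distrib_left mult.assoc)
  have int: "i \<in> I \<Longrightarrow> integrable M (\<lambda>\<omega>. exp ((l * a i) * X i \<omega>))" for i
    using X unfolding sub_gaussian_def by blast
  have ind': "indep_vars (\<lambda>_. borel) (\<lambda>i \<omega>. exp ((l * a i) * X i \<omega>)) I"
    by (rule indep_vars_compose2[OF ind]) auto
  show "integrable M (\<lambda>\<omega>. exp (l * (\<Sum>i\<in>I. a i * X i \<omega>)))"
    unfolding eq by (rule indep_vars_integrable[OF fin ind' int])
  have "expectation (\<lambda>\<omega>. exp (l * (\<Sum>i\<in>I. a i * X i \<omega>)))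
      = (\<Prod>i\<in>I. expectation (\<lambda>\<omega>. exp ((l * a i) * X i \<omega>)))"
    unfolding eq by (rule indep_vars_lebesgue_integral[OF fin ind' int])
  also have "\<dots> \<le> (\<Prod>i\<in>I. exp ((l * a i)\<^sup>2 * 1 / 2))"
    using X unfolding sub_gaussian_def by (intro prod_mono) auto
  also have "\<dots> = exp (l\<^sup>2 * (\<Sum>i\<in>I. (a i)\<^sup>2) / 2)"
    using fin by (simp add: exp_sum[symmetric] sum_distrib_left power_mult_distrib sum_divide_distrib)
  finally show "expectation (\<lambda>\<omega>. exp (l * (\<Sum>i\<in>I. a i * X i \<omega>))) \<le> exp (l\<^sup>2 * (\<Sum>i\<in>I. (a i)\<^sup>2) / 2)" .
qed

text \<open>The means vanish, so only the variances contribute. Hence the second moment of the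
  combination equals its variance proxy, as the quadratic bound on
  \<open>exp (\<eta> * X\<^sup>2)\<close> demands.\<close>

lemma sub_gaussian_linear_combination_second_moment:
  fixes X :: "'i \<Rightarrow> 'a \<Rightarrow> real"
  assumes fin: "finite I" and ind: "indep_vars (\<lambda>_. borel) X I"
    and X: "\<And>i. i \<in> I \<Longrightarrow> sub_gaussian M 1 (X i)" "\<And>i. i \<in> I \<Longrightarrow> variance (X i) = 1"
  shows "expectation (\<lambda>\<omega>. (\<Sum>i\<in>I. a i * X i \<omega>)\<^sup>2) = (\<Sum>i\<in>I. (a i)\<^sup>2)"
proof -
  have mean: "i \<in> I \<Longrightarrow> expectation (X i) = 0" for i
    using X(1) by (rule sub_gaussian_expectation)
  have int: "i \<in> I \<Longrightarrow> integrable M (X i)" "i \<in> I \<Longrightarrow> integrable M (\<lambda>\<omega>. (X i \<omega>)\<^sup>2)" for i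
    using sub_gaussian_integrable_power[OF X(1), of i 1] sub_gaussian_integrable_power[OF X(1), of i 2]
    by simp_all
  have ind': "indep_vars (\<lambda>_. borel) (\<lambda>i \<omega>. a i * X i \<omega>) I"
    by (rule indep_vars_compose2[OF ind]) auto
  have sq: "i \<in> I \<Longrightarrow> expectation (\<lambda>\<omega>. (X i \<omega>)\<^sup>2) = 1" for i
    using X(2)[of i] mean[of i] by simp
  show ?thesis
    by (subst indep_vars_sum_second_moment(2)[OF fin ind'])
       (use int in \<open>auto simp: power_mult_distrib mean sq\<close>)
qed

section \<open>Conditioning and regrouping of independent families\<close>

text \<open>The joint law is a product measure, so Tonelli applies. This stands in for conditioning:
  \<open>X\<close> is frozen at \<open>\<omega>'\<close> while \<open>Y\<close> is
  integrated.\<close>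

lemma nn_integral_indep_var:
  assumes ind: "indep_var S X T Y" and F: "case_prod F \<in> borel_measurable (S \<Otimes>\<^sub>M T)"
  shows "(\<integral>\<^sup>+\<omega>. F (X \<omega>) (Y \<omega>) \<partial>M) = (\<integral>\<^sup>+\<omega>'. \<integral>\<^sup>+\<omega>. F (X \<omega>') (Y \<omega>) \<partial>M \<partial>M)"
proof -
  note F[measurable]
  have [measurable]: "X \<in> measurable M S" "Y \<in> measurable M T"
    using ind by (auto dest: indep_var_rv1 indep_var_rv2)
  interpret Y: prob_space "distr M T Y" by (rule prob_space_distr) measurable
  have "(\<integral>\<^sup>+\<omega>. F (X \<omega>) (Y \<omega>) \<partial>M) = (\<integral>\<^sup>+z. case_prod F z \<partial>distr M (S \<Otimes>\<^sub>M T) (\<lambda>x. (X x, Y x)))"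
    by (subst nn_integral_distr) auto
  also have "\<dots> = (\<integral>\<^sup>+z. case_prod F z \<partial>(distr M S X \<Otimes>\<^sub>M distr M T Y))"
    using ind by (simp add: indep_var_distribution_eq)
  also have "\<dots> = (\<integral>\<^sup>+x. \<integral>\<^sup>+y. F x y \<partial>distr M T Y \<partial>distr M S X)"
    by (subst Y.nn_integral_fst[symmetric]) (auto simp: F cong: measurable_cong_sets)
  also have "\<dots> = (\<integral>\<^sup>+\<omega>'. \<integral>\<^sup>+\<omega>. F (X \<omega>') (Y \<omega>) \<partial>M \<partial>M)"
  proof -
    have "(\<integral>\<^sup>+y. F x y \<partial>distr M T Y) = (\<integral>\<^sup>+\<omega>. F x (Y \<omega>) \<partial>M)" if "x \<in> space S" for x
      using that by (subst nn_integral_distr) auto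
    then have "(\<integral>\<^sup>+x. \<integral>\<^sup>+y. F x y \<partial>distr M T Y \<partial>distr M S X) = (\<integral>\<^sup>+x. \<integral>\<^sup>+\<omega>. F x (Y \<omega>) \<partial>M \<partial>distr M S X)"
      by (intro nn_integral_cong) simp
    also have "\<dots> = (\<integral>\<^sup>+\<omega>'. \<integral>\<^sup>+\<omega>. F (X \<omega>') (Y \<omega>) \<partial>M \<partial>M)"
      by (rule nn_integral_distr) measurable
    finally show ?thesis .
  qed
  finally show ?thesis .
qed

text \<open>The index blocks of distinct rows are disjoint, so the restricted families are
  independent; each row vector is a measurable function of its block.\<close>

lemma indep_vars_rows:
  fixes X :: "'a \<Rightarrow> real ^ 'p ^ 'd"
  assumes "indep_vars (\<lambda>_. borel) (\<lambda>(i, k) \<omega>. X \<omega> $ i $ k) UNIV"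
  shows "indep_vars (\<lambda>_. borel) (\<lambda>i \<omega>. X \<omega> $ i) UNIV"
proof -
  let ?K = "\<lambda>i. {i} \<times> (UNIV :: 'p set)"
  have "indep_vars (\<lambda>i. PiM (?K i) (\<lambda>_. borel))
      (\<lambda>i \<omega>. restrict (\<lambda>j. (case j of (i, k) \<Rightarrow> \<lambda>\<omega>. X \<omega> $ i $ k) \<omega>) (?K i)) (UNIV :: 'd set)"
    by (rule indep_vars_restrict[OF assms]) (auto simp: disjoint_family_on_def)
  then have "indep_vars (\<lambda>_. borel) (\<lambda>i \<omega>. (\<lambda>f. (\<chi> k. f (i, k)) :: real ^ 'p)
      (restrict (\<lambda>j. (case j of (i, k) \<Rightarrow> \<lambda>\<omega>. X \<omega> $ i $ k) \<omega>) (?K i))) (UNIV :: 'd set)"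
  proof (rule indep_vars_compose2)
    fix i :: 'd
    show "(\<lambda>f. (\<chi> k. f (i, k)) :: real ^ 'p) \<in> measurable (PiM (?K i) (\<lambda>_. borel)) borel"
      by (subst borel_measurable_euclidean_space)
         (auto simp: Basis_vec_def inner_axis intro!: measurable_component_singleton)
  qed
  then show ?thesis by (simp add: vec_lambda_unique)
qed

text \<open>Grouping into singleton blocks \<open>{(i, k)}\<close> reindexes the family along row
  \<open>i\<close>.\<close>

lemma indep_vars_row_entries:
  fixes X :: "'a \<Rightarrow> real ^ 'p ^ 'd"
  assumes "indep_vars (\<lambda>_. borel) (\<lambda>(i, k) \<omega>. X \<omega> $ i $ k) UNIV"
  shows "indep_vars (\<lambda>_. borel) (\<lambda>k \<omega>. X \<omega> $ i $ k) UNIV"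
proof -
  have "indep_vars (\<lambda>k. PiM {(i, k)} (\<lambda>_. borel))
      (\<lambda>k \<omega>. restrict (\<lambda>j. (case j of (i, k) \<Rightarrow> \<lambda>\<omega>. X \<omega> $ i $ k) \<omega>) {(i, k)}) UNIV"
    by (rule indep_vars_restrict[OF assms]) (auto simp: disjoint_family_on_def)
  then have "indep_vars (\<lambda>_. borel) (\<lambda>k \<omega>. (\<lambda>f. f (i, k) :: real)
      (restrict (\<lambda>j. (case j of (i, k) \<Rightarrow> \<lambda>\<omega>. X \<omega> $ i $ k) \<omega>) {(i, k)})) UNIV"
    by (rule indep_vars_compose2) (auto intro!: measurable_component_singleton)
  then show ?thesis by simp
qed

end

section \<open>Measurability of components and Bernoulli expectations\<close>

lemma borel_measurable_vec_nth [measurable]: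
  "(\<lambda>v :: 'b::euclidean_space ^ 'n. v $ i) \<in> borel_measurable borel"
  by (intro borel_measurable_continuous_onI continuous_intros)

lemma bernoulli_rv_expectation:
  assumes X: "bernoulli_rv M q X" and [measurable]: "g \<in> borel_measurable borel"
  shows "integrable M (\<lambda>\<omega>. g (X \<omega>))"
    and "(\<integral>\<omega>. g (X \<omega>) \<partial>M) = q * g 1 + (1 - q) * (g 0 :: real)"
proof -
  let ?B = "distr (measure_pmf (bernoulli_pmf q)) borel (of_bool :: bool \<Rightarrow> real)"
  have q: "0 \<le> q" "q \<le> 1" and [measurable]: "X \<in> borel_measurable M" and eq: "distr M borel X = ?B"
    using X by (auto simp: bernoulli_rv_def)
  have "integrable ?B g"
    by (subst integrable_distr_eq) (auto intro!: integrable_measure_pmf_finite)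
  then show "integrable M (\<lambda>\<omega>. g (X \<omega>))"
    unfolding eq[symmetric] by (subst (asm) integrable_distr_eq) auto
  have "(\<integral>\<omega>. g (X \<omega>) \<partial>M) = integral\<^sup>L ?B g"
    unfolding eq[symmetric] by (subst integral_distr) auto
  also have "\<dots> = q * g 1 + (1 - q) * g 0"
    using q by (subst integral_distr) (auto simp: mult.commute)
  finally show "(\<integral>\<omega>. g (X \<omega>) \<partial>M) = q * g 1 + (1 - q) * g 0" .
qed

subsection \<open>Row sums of a sparse random matrix\<close>

text \<open>The vector \<open>c\<close> stands for one difference vector, rescaled. In these terms
  \<open>c_le\<close> is the lower bound on \<open>q\<close>, and \<open>c_normalised\<close> says
  that the conditional variance of a row sum has mean 1.\<close>

locale sparse_projection = prob_space M for M :: "'a measure" +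
  fixes U \<zeta> :: "'a \<Rightarrow> real ^ 'p ^ 'd" and q :: real and c :: "real ^ 'p"
  assumes U_indep: "indep_vars (\<lambda>_. borel) (\<lambda>(i, k) \<omega>. U \<omega> $ i $ k) UNIV"
    and U_sub_gaussian: "\<And>i k. sub_gaussian M 1 (\<lambda>\<omega>. U \<omega> $ i $ k)"
    and U_variance: "\<And>i k. variance (\<lambda>\<omega>. U \<omega> $ i $ k) = 1"
    and \<zeta>_indep: "indep_vars (\<lambda>_. borel) (\<lambda>(i, k) \<omega>. \<zeta> \<omega> $ i $ k) UNIV"
    and \<zeta>_bernoulli: "\<And>i k. bernoulli_rv M q (\<lambda>\<omega>. \<zeta> \<omega> $ i $ k)"
    and \<zeta>_U_indep: "indep_var borel \<zeta> borel U"
    and c_le: "\<And>k. (c $ k)\<^sup>2 \<le> 1"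
    and c_normalised: "q * (\<Sum>k\<in>UNIV. (c $ k)\<^sup>2) = 1"
begin

text \<open>The arguments are plain vectors rather than random ones, so that the row
  \<open>z\<close> of \<zeta> can be frozen while the row \<open>u\<close> of \<open>U\<close> stays
  random.\<close>

definition row_value :: "real ^ 'p \<Rightarrow> real ^ 'p \<Rightarrow> real" where
  "row_value z u = (\<Sum>k\<in>UNIV. z $ k * c $ k * u $ k)"

definition row_variance :: "real ^ 'p \<Rightarrow> real" where
  "row_variance z = (\<Sum>k\<in>UNIV. (z $ k * c $ k)\<^sup>2)"

lemma U_measurable [measurable]: "U \<in> borel_measurable M"
  and \<zeta>_measurable [measurable]: "\<zeta> \<in> borel_measurable M"
  using \<zeta>_U_indep by (auto dest: indep_var_rv1 indep_var_rv2)

lemma row_variance_measurable [measurable]: "row_variance \<in> borel_measurable borel"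
  unfolding row_variance_def by measurable

lemma row_value_measurable [measurable (raw)]:
  assumes [measurable]: "f \<in> borel_measurable N" "g \<in> borel_measurable N"
  shows "(\<lambda>x. row_value (f x) (g x)) \<in> borel_measurable N"
  unfolding row_value_def by measurable

lemma row_variance_nonneg: "0 \<le> row_variance z"
  by (auto simp: row_variance_def intro: sum_nonneg)

lemma q_range: "0 \<le> q" "q \<le> 1"
  using \<zeta>_bernoulli by (auto simp: bernoulli_rv_def)

lemma sub_gaussian_row_value: "sub_gaussian M (row_variance z) (\<lambda>\<omega>. row_value z (U \<omega> $ i))"
  unfolding row_value_def row_variance_def
  by (intro sub_gaussian_linear_combination indep_vars_row_entries U_indep U_sub_gaussian) simp

lemma row_value_second_moment: "expectation (\<lambda>\<omega>. (row_value z (U \<omega> $ i))\<^sup>2) = row_variance z"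
  unfolding row_value_def row_variance_def
  by (intro sub_gaussian_linear_combination_second_moment indep_vars_row_entries U_indep
      U_sub_gaussian U_variance) simp

lemma indep_entry_variances: "indep_vars (\<lambda>_. borel) (\<lambda>k \<omega>. (\<zeta> \<omega> $ i $ k * c $ k)\<^sup>2) UNIV"
  by (rule indep_vars_compose2[OF indep_vars_row_entries[OF \<zeta>_indep]]) measurable

text \<open>A summand of the row variance equals \<open>(c $ k)\<^sup>2\<close> with probability
  \<open>q\<close> and 0 otherwise. A general \<open>g\<close> covers first, second and exponential
  moments at once.\<close>

lemma entry_variance_expectation:
  assumes [measurable]: "g \<in> borel_measurable borel"
  shows "integrable M (\<lambda>\<omega>. g ((\<zeta> \<omega> $ i $ k * c $ k)\<^sup>2))"
    and "expectation (\<lambda>\<omega>. g ((\<zeta> \<omega> $ i $ k * c $ k)\<^sup>2)) = q * g ((c $ k)\<^sup>2) + (1 - q) * (g 0 :: real)"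
  using bernoulli_rv_expectation[OF \<zeta>_bernoulli[of i k], of "\<lambda>y. g ((y * c $ k)\<^sup>2)"] by simp_all

section \<open>Moments and tail of the conditional row variance\<close>

text \<open>With w = \<open>(c $ k)\<^sup>2\<close> in [0, 1] one has w^2 \<le> w, so the variances
  q w^2 - (q w)^2 sum to at most 1; the squared mean contributes the other 1.\<close>

lemma row_variance_moments:
  shows "integrable M (\<lambda>\<omega>. row_variance (\<zeta> \<omega> $ i))"
    and "expectation (\<lambda>\<omega>. row_variance (\<zeta> \<omega> $ i)) = 1"
    and "integrable M (\<lambda>\<omega>. (row_variance (\<zeta> \<omega> $ i))\<^sup>2)"
    and "expectation (\<lambda>\<omega>. (row_variance (\<zeta> \<omega> $ i))\<^sup>2) \<le> 2"
proof -
  note E1 = entry_variance_expectation[of "\<lambda>y. y" i, simplified]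
  note E2 = entry_variance_expectation[of "\<lambda>y. y\<^sup>2" i, simplified]
  show "integrable M (\<lambda>\<omega>. row_variance (\<zeta> \<omega> $ i))"
    unfolding row_variance_def using E1 by auto
  show "expectation (\<lambda>\<omega>. row_variance (\<zeta> \<omega> $ i)) = 1"
    unfolding row_variance_def using E1 c_normalised by (simp add: sum_distrib_left)
  show "integrable M (\<lambda>\<omega>. (row_variance (\<zeta> \<omega> $ i))\<^sup>2)"
    unfolding row_variance_def
    by (rule indep_vars_sum_second_moment(1)[OF _ indep_entry_variances]) (use E1 E2 in auto)
  have "expectation (\<lambda>\<omega>. (row_variance (\<zeta> \<omega> $ i))\<^sup>2)
      = (\<Sum>k\<in>UNIV. q * (c $ k)\<^sup>2)\<^sup>2 + (\<Sum>k\<in>UNIV. q * ((c $ k)\<^sup>2)\<^sup>2 - (q * (c $ k)\<^sup>2)\<^sup>2)"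
    unfolding row_variance_def
    by (subst indep_vars_sum_second_moment(2)[OF _ indep_entry_variances])
       (use E1 E2 in \<open>auto simp del: power_mult_distrib\<close>)
  also have "\<dots> \<le> 1 + (\<Sum>k\<in>UNIV. q * (c $ k)\<^sup>2)"
  proof (intro add_mono sum_mono)
    fix k
    have "q * ((c $ k)\<^sup>2)\<^sup>2 - (q * (c $ k)\<^sup>2)\<^sup>2 \<le> q * ((c $ k)\<^sup>2)\<^sup>2"
      by simp
    also have "\<dots> \<le> q * ((c $ k)\<^sup>2 * 1)"
      unfolding power2_eq_square[of "(c $ k)\<^sup>2"] using q_range c_le by (intro mult_left_mono) auto
    finally show "q * ((c $ k)\<^sup>2)\<^sup>2 - (q * (c $ k)\<^sup>2)\<^sup>2 \<le> q * (c $ k)\<^sup>2" by simp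
  qed (use c_normalised in \<open>simp add: sum_distrib_left\<close>)
  also have "\<dots> = 2"
    using c_normalised by (simp add: sum_distrib_left)
  finally show "expectation (\<lambda>\<omega>. (row_variance (\<zeta> \<omega> $ i))\<^sup>2) \<le> 2" .
qed

text \<open>On [0, 1], exp w \<le> 1 + w + w^2 \<le> 1 + 2 w. Each independent factor is therefore
  at most 1 + 2 q w \<le> exp (2 q w), and the q w sum to 1.\<close>

lemma row_variance_exp_moment:
  shows "integrable M (\<lambda>\<omega>. exp (row_variance (\<zeta> \<omega> $ i)))"
    and "expectation (\<lambda>\<omega>. exp (row_variance (\<zeta> \<omega> $ i))) \<le> exp 2"
proof -
  note E = entry_variance_expectation[of exp i, simplified]
  have eq: "exp (row_variance (\<zeta> \<omega> $ i)) = (\<Prod>k\<in>UNIV. exp ((\<zeta> \<omega> $ i $ k * c $ k)\<^sup>2))" for \<omega>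
    by (simp add: row_variance_def exp_sum)
  have ind: "indep_vars (\<lambda>_. borel) (\<lambda>k \<omega>. exp ((\<zeta> \<omega> $ i $ k * c $ k)\<^sup>2)) UNIV"
    by (rule indep_vars_compose2[OF indep_entry_variances]) measurable
  show "integrable M (\<lambda>\<omega>. exp (row_variance (\<zeta> \<omega> $ i)))"
    unfolding eq by (rule indep_vars_integrable[OF _ ind]) (use E in auto)
  have "expectation (\<lambda>\<omega>. exp (row_variance (\<zeta> \<omega> $ i))) = (\<Prod>k\<in>UNIV. q * exp ((c $ k)\<^sup>2) + (1 - q))"
    unfolding eq by (subst indep_vars_lebesgue_integral[OF _ ind]) (use E in auto)
  also have "\<dots> \<le> (\<Prod>k\<in>UNIV. exp (2 * (q * (c $ k)\<^sup>2)))"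
  proof (intro prod_mono conjI)
    fix k
    show "0 \<le> q * exp ((c $ k)\<^sup>2) + (1 - q)" using q_range by simp
    have "exp ((c $ k)\<^sup>2) \<le> 1 + (c $ k)\<^sup>2 + ((c $ k)\<^sup>2)\<^sup>2"
      using c_le by (intro exp_bound) auto
    also have "\<dots> \<le> 1 + (c $ k)\<^sup>2 + (c $ k)\<^sup>2 * 1"
      unfolding power2_eq_square[of "(c $ k)\<^sup>2"] using c_le by (intro add_mono mult_left_mono) auto
    finally have "q * exp ((c $ k)\<^sup>2) \<le> q * (1 + (c $ k)\<^sup>2 + (c $ k)\<^sup>2 * 1)"
      using q_range by (intro mult_left_mono) auto
    then have "q * exp ((c $ k)\<^sup>2) + (1 - q) \<le> 1 + 2 * (q * (c $ k)\<^sup>2)"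
      by (simp add: algebra_simps)
    also have "\<dots> \<le> exp (2 * (q * (c $ k)\<^sup>2))" by (rule exp_ge_add_one_self)
    finally show "q * exp ((c $ k)\<^sup>2) + (1 - q) \<le> exp (2 * (q * (c $ k)\<^sup>2))" .
  qed
  also have "\<dots> = exp (2 * (q * (\<Sum>k\<in>UNIV. (c $ k)\<^sup>2)))"
    by (simp add: exp_sum[symmetric] sum_distrib_left)
  finally show "expectation (\<lambda>\<omega>. exp (row_variance (\<zeta> \<omega> $ i))) \<le> exp 2"
    using c_normalised by simp
qed

text \<open>Markov's inequality for the exponential moment of each row, then a union bound over the
  rows.\<close>

lemma prob_row_variance_gt:
  "prob {\<omega> \<in> space M. \<exists>i. B < row_variance (\<zeta> \<omega> $ i)} \<le> real CARD('d) * exp (2 - B)"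
proof -
  have "prob {\<omega> \<in> space M. B < row_variance (\<zeta> \<omega> $ i)} \<le> exp (2 - B)" for i
  proof -
    have "prob {\<omega> \<in> space M. B < row_variance (\<zeta> \<omega> $ i)}
        \<le> prob {\<omega> \<in> space M. exp B \<le> exp (row_variance (\<zeta> \<omega> $ i))}"
      by (intro finite_measure_mono) auto
    also have "\<dots> \<le> expectation (\<lambda>\<omega>. exp (row_variance (\<zeta> \<omega> $ i))) / exp B"
      by (intro integral_Markov_inequality_measure[where A = "space M"])
         (auto simp: row_variance_exp_moment)
    also have "\<dots> \<le> exp 2 / exp B"
      by (intro divide_right_mono row_variance_exp_moment) simp
    finally show ?thesis by (simp add: exp_diff)
  qed
  then have "(\<Sum>i\<in>(UNIV :: 'd set). prob {\<omega> \<in> space M. B < row_variance (\<zeta> \<omega> $ i)})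
      \<le> real CARD('d) * exp (2 - B)"
    by (intro sum_bounded_above) auto
  moreover have "{\<omega> \<in> space M. \<exists>i. B < row_variance (\<zeta> \<omega> $ i)}
      = (\<Union>i\<in>UNIV. {\<omega> \<in> space M. B < row_variance (\<zeta> \<omega> $ i)})" by auto
  moreover have "prob (\<Union>i\<in>UNIV. {\<omega> \<in> space M. B < row_variance (\<zeta> \<omega> $ i)})
      \<le> (\<Sum>i\<in>UNIV. prob {\<omega> \<in> space M. B < row_variance (\<zeta> \<omega> $ i)})"
    by (rule finite_measure_subadditive_finite) auto
  ultimately show ?thesis by simp
qed

section \<open>Chernoff bounds under truncation\<close>

text \<open>The indicator kills rows on which the quadratic bound could fail. With \<zeta> frozen,
  the rows of \<open>U\<close> are independent and each contributes at most \<open>b\<close>, which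
  no longer contains the indicator. Independence of the rows of \<zeta> then leaves only moments of
  the untruncated row variance.\<close>

lemma truncated_exp_moment:
  assumes "\<eta> * B \<le> 1 / 8"
  shows "(\<integral>\<^sup>+\<omega>. (\<Prod>i\<in>UNIV. indicator {..B} (row_variance (\<zeta> \<omega> $ i))
        * ennreal (exp (\<eta> * (row_value (\<zeta> \<omega> $ i) (U \<omega> $ i))\<^sup>2))) \<partial>M)
    \<le> ennreal (exp (real CARD('d) * (\<eta> + 4 * \<eta>\<^sup>2)))"
proof -
  define f :: "real ^ 'p \<Rightarrow> real ^ 'p \<Rightarrow> ennreal" where
    "f z u = indicator {..B} (row_variance z) * ennreal (exp (\<eta> * (row_value z u)\<^sup>2))" for z u
  define b where "b z = 1 + \<eta> * row_variance z + 2 * \<eta>\<^sup>2 * (row_variance z)\<^sup>2" for z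
  have [measurable]: "case_prod f \<in> borel_measurable (borel \<Otimes>\<^sub>M borel)" "b \<in> borel_measurable borel"
    unfolding f_def b_def by measurable
  have b_nonneg: "0 \<le> b z" for z
  proof -
    have "b z = (1 + \<eta> * row_variance z / 2)\<^sup>2 + 7 / 4 * (\<eta> * row_variance z)\<^sup>2"
      by (simp add: b_def power2_eq_square field_simps)
    then show ?thesis by simp
  qed
  have f_le: "(\<integral>\<^sup>+\<omega>. f z (U \<omega> $ i) \<partial>M) \<le> ennreal (b z)" for z i
  proof (cases "row_variance z \<le> B")
    case True
    have "\<eta> * row_variance z \<le> 1 / 8"
    proof (cases "0 \<le> \<eta>")
      case False
      then have "\<eta> * row_variance z \<le> 0"
        using row_variance_nonneg by (simp add: mult_nonpos_nonneg)
      then show ?thesis by simp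
    qed (use True assms mult_left_mono[of "row_variance z" B \<eta>] in linarith)
    then show ?thesis
      using sub_gaussian_exp_square_le_quadratic[OF sub_gaussian_row_value row_value_second_moment] True
      by (simp add: f_def b_def)
  qed (simp add: f_def)
  have b_le: "(\<integral>\<^sup>+\<omega>. ennreal (b (\<zeta> \<omega> $ i)) \<partial>M) \<le> ennreal (exp (\<eta> + 4 * \<eta>\<^sup>2))" for i
  proof -
    note V = row_variance_moments[of i]
    have "(\<integral>\<^sup>+\<omega>. ennreal (b (\<zeta> \<omega> $ i)) \<partial>M) = ennreal (expectation (\<lambda>\<omega>. b (\<zeta> \<omega> $ i)))"
      using b_nonneg V by (intro nn_integral_eq_integral) (auto simp: b_def)
    also have "expectation (\<lambda>\<omega>. b (\<zeta> \<omega> $ i))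
        = 1 + \<eta> + 2 * \<eta>\<^sup>2 * expectation (\<lambda>\<omega>. (row_variance (\<zeta> \<omega> $ i))\<^sup>2)"
      using V by (simp add: b_def prob_space)
    also have "\<dots> \<le> 1 + \<eta> + 2 * \<eta>\<^sup>2 * 2"
      using V(4) by (intro add_mono mult_left_mono) auto
    also have "\<dots> \<le> exp (\<eta> + 4 * \<eta>\<^sup>2)"
      using exp_ge_add_one_self[of "\<eta> + 4 * \<eta>\<^sup>2"] by linarith
    finally show ?thesis by (simp add: ennreal_leI)
  qed
  have "(\<integral>\<^sup>+\<omega>. (\<Prod>i\<in>UNIV. f (\<zeta> \<omega> $ i) (U \<omega> $ i)) \<partial>M)
      = (\<integral>\<^sup>+\<omega>'. \<integral>\<^sup>+\<omega>. (\<Prod>i\<in>UNIV. f (\<zeta> \<omega>' $ i) (U \<omega> $ i)) \<partial>M \<partial>M)"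
    by (rule nn_integral_indep_var[OF \<zeta>_U_indep]) measurable
  also have "\<dots> \<le> (\<integral>\<^sup>+\<omega>'. (\<Prod>i\<in>UNIV. ennreal (b (\<zeta> \<omega>' $ i))) \<partial>M)"
  proof (rule nn_integral_mono)
    fix \<omega>'
    have "indep_vars (\<lambda>_. borel) (\<lambda>i \<omega>. f (\<zeta> \<omega>' $ i) (U \<omega> $ i)) UNIV"
      by (rule indep_vars_compose2[OF indep_vars_rows[OF U_indep]]) measurable
    then have "(\<integral>\<^sup>+\<omega>. (\<Prod>i\<in>UNIV. f (\<zeta> \<omega>' $ i) (U \<omega> $ i)) \<partial>M)
        = (\<Prod>i\<in>UNIV. \<integral>\<^sup>+\<omega>. f (\<zeta> \<omega>' $ i) (U \<omega> $ i) \<partial>M)"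
      by (intro indep_vars_nn_integral) auto
    also have "\<dots> \<le> (\<Prod>i\<in>UNIV. ennreal (b (\<zeta> \<omega>' $ i)))"
      by (intro prod_mono_ennreal f_le)
    finally show "(\<integral>\<^sup>+\<omega>. (\<Prod>i\<in>UNIV. f (\<zeta> \<omega>' $ i) (U \<omega> $ i)) \<partial>M) \<le> (\<Prod>i\<in>UNIV. ennreal (b (\<zeta> \<omega>' $ i)))" .
  qed
  also have "\<dots> = (\<Prod>i\<in>UNIV. \<integral>\<^sup>+\<omega>. ennreal (b (\<zeta> \<omega> $ i)) \<partial>M)"
  proof (rule indep_vars_nn_integral)
    show "indep_vars (\<lambda>_. borel) (\<lambda>i \<omega>. ennreal (b (\<zeta> \<omega> $ i))) UNIV"
      by (rule indep_vars_compose2[OF indep_vars_rows[OF \<zeta>_indep]]) measurable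
  qed auto
  also have "\<dots> \<le> (\<Prod>i\<in>(UNIV :: 'd set). ennreal (exp (\<eta> + 4 * \<eta>\<^sup>2)))"
    by (intro prod_mono_ennreal b_le)
  also have "\<dots> = ennreal (exp (real CARD('d) * (\<eta> + 4 * \<eta>\<^sup>2)))"
    by (simp add: ennreal_power exp_of_nat_mult)
  finally show ?thesis by (simp add: f_def)
qed

text \<open>On the event every truncation indicator is 1, so \<open>exp (- a)\<close> times the
  truncated exponential dominates the indicator of the event. As the sign of \<eta> is free, this
  covers both tails.\<close>

lemma truncated_chernoff:
  assumes "\<eta> * B \<le> 1 / 8"
  shows "prob {\<omega> \<in> space M. (\<forall>i. row_variance (\<zeta> \<omega> $ i) \<le> B) \<and>
      a \<le> \<eta> * (\<Sum>i\<in>UNIV. (row_value (\<zeta> \<omega> $ i) (U \<omega> $ i))\<^sup>2)}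
    \<le> exp (real CARD('d) * (\<eta> + 4 * \<eta>\<^sup>2) - a)" (is "prob ?E \<le> _")
proof -
  let ?f = "\<lambda>\<omega>. \<Prod>i\<in>UNIV. indicator {..B} (row_variance (\<zeta> \<omega> $ i))
        * ennreal (exp (\<eta> * (row_value (\<zeta> \<omega> $ i) (U \<omega> $ i))\<^sup>2))"
  have "ennreal (prob ?E) = (\<integral>\<^sup>+\<omega>. indicator ?E \<omega> \<partial>M)"
    by (subst nn_integral_indicator) (auto simp: emeasure_eq_measure)
  also have "\<dots> \<le> (\<integral>\<^sup>+\<omega>. ennreal (exp (- a)) * ?f \<omega> \<partial>M)"
  proof (intro nn_integral_mono)
    fix \<omega>
    show "indicator ?E \<omega> \<le> ennreal (exp (- a)) * ?f \<omega>"
    proof (cases "\<omega> \<in> ?E")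
      case True
      then have "?f \<omega> = ennreal (exp (\<eta> * (\<Sum>i\<in>UNIV. (row_value (\<zeta> \<omega> $ i) (U \<omega> $ i))\<^sup>2)))"
        by (simp add: prod_ennreal exp_sum sum_distrib_left)
      moreover have "1 \<le> exp (- a) * exp (\<eta> * (\<Sum>i\<in>UNIV. (row_value (\<zeta> \<omega> $ i) (U \<omega> $ i))\<^sup>2))"
        using True by (simp add: mult_exp_exp)
      ultimately show ?thesis
        using True by (simp add: ennreal_mult'[symmetric])
    qed simp
  qed
  also have "\<dots> = ennreal (exp (- a)) * (\<integral>\<^sup>+\<omega>. ?f \<omega> \<partial>M)"
    by (rule nn_integral_cmult) measurable
  also have "\<dots> \<le> ennreal (exp (- a)) * ennreal (exp (real CARD('d) * (\<eta> + 4 * \<eta>\<^sup>2)))"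
    using truncated_exp_moment[OF assms] by (rule mult_left_mono) simp
  also have "\<dots> = ennreal (exp (real CARD('d) * (\<eta> + 4 * \<eta>\<^sup>2) - a))"
    by (simp add: ennreal_mult'[symmetric] mult_exp_exp)
  finally show ?thesis by simp
qed

text \<open>A deviation outside the window forces a row variance above \<open>B\<close>, a truncated
  lower deviation or a truncated upper one; the three summands of the bound correspond to
  these.\<close>

lemma prob_sum_row_value_deviation:
  assumes "0 < \<epsilon>" "\<epsilon> < 1" "0 < B"
  shows "prob {\<omega> \<in> space M. \<not> (real CARD('d) * (1 - \<epsilon> / 2) \<le> (\<Sum>i\<in>UNIV. (row_value (\<zeta> \<omega> $ i) (U \<omega> $ i))\<^sup>2) \<and>
      (\<Sum>i\<in>UNIV. (row_value (\<zeta> \<omega> $ i) (U \<omega> $ i))\<^sup>2) \<le> real CARD('d) * (1 + \<epsilon>))}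
    \<le> real CARD('d) * exp (2 - B) + exp (- (real CARD('d) * \<epsilon>\<^sup>2 / 64))
      + exp (- (real CARD('d) * \<epsilon>\<^sup>2 * (1 / (8 * B) - 1 / (16 * B\<^sup>2))))" (is "prob ?E \<le> _")
proof -
  let ?d = "real CARD('d)"
  let ?S = "\<lambda>\<omega>. \<Sum>i\<in>UNIV. (row_value (\<zeta> \<omega> $ i) (U \<omega> $ i))\<^sup>2"
  let ?T = "{\<omega> \<in> space M. \<exists>i. B < row_variance (\<zeta> \<omega> $ i)}"
  \<comment> \<open>The division by \<open>B\<close> ensures \<open>\<eta> * B \<le> 1 / 8\<close>.
    The choice of \<theta> minimises the lower-tail exponent 4 \<theta>^2 + \<theta> \<epsilon> / 2,
    with value - \<epsilon>^2 / 64; being negative, it meets the truncation condition for every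
    \<open>B\<close>.\<close>
  define \<eta> where "\<eta> = \<epsilon> / (8 * B)"
  define \<theta> where "\<theta> = - \<epsilon> / 16"
  let ?P = "\<lambda>t a. {\<omega> \<in> space M. (\<forall>i. row_variance (\<zeta> \<omega> $ i) \<le> B) \<and> a \<le> t * ?S \<omega>}"
  have "\<eta> > 0" "\<theta> < 0" using assms by (simp_all add: \<eta>_def \<theta>_def)
  have "prob ?E \<le> prob (?T \<union> ?P \<theta> (\<theta> * (?d * (1 - \<epsilon> / 2))) \<union> ?P \<eta> (\<eta> * (?d * (1 + \<epsilon>))))"
    using \<open>\<eta> > 0\<close> \<open>\<theta> < 0\<close>
    by (intro finite_measure_mono) (auto simp: not_le not_less intro: less_imp_le)
  also have "\<dots> \<le> prob ?T + prob (?P \<theta> (\<theta> * (?d * (1 - \<epsilon> / 2)))) + prob (?P \<eta> (\<eta> * (?d * (1 + \<epsilon>))))"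
    by (intro order_trans[OF measure_Un_le] add_right_mono measure_Un_le) measurable
  also have "\<dots> \<le> ?d * exp (2 - B) + exp (?d * (\<theta> + 4 * \<theta>\<^sup>2) - \<theta> * (?d * (1 - \<epsilon> / 2)))
      + exp (?d * (\<eta> + 4 * \<eta>\<^sup>2) - \<eta> * (?d * (1 + \<epsilon>)))"
  proof (intro add_mono prob_row_variance_gt truncated_chernoff)
    show "\<eta> * B \<le> 1 / 8" using assms by (simp add: \<eta>_def)
    show "\<theta> * B \<le> 1 / 8" using \<open>\<theta> < 0\<close> assms(3) mult_neg_pos[of \<theta> B] by linarith
  qed
  also have "?d * (\<theta> + 4 * \<theta>\<^sup>2) - \<theta> * (?d * (1 - \<epsilon> / 2)) = - (?d * \<epsilon>\<^sup>2 / 64)"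
    by (simp add: \<theta>_def power2_eq_square field_simps)
  also have "?d * (\<eta> + 4 * \<eta>\<^sup>2) - \<eta> * (?d * (1 + \<epsilon>)) = - (?d * \<epsilon>\<^sup>2 * (1 / (8 * B) - 1 / (16 * B\<^sup>2)))"
    using assms by (simp add: \<eta>_def power2_eq_square field_simps)
  finally show ?thesis .
qed

end

subsection \<open>Norm distortion\<close>

text \<open>In units of \<delta> / n^2 the truncation costs at most 5/8 and each Chernoff term at
  most 1/9, which together stay below 1.\<close>

lemma failure_probability_le:
  fixes D \<epsilon> \<delta> B :: real and n :: nat
  assumes n: "2 \<le> n" and D: "1 \<le> D" and \<epsilon>: "0 < \<epsilon>" and \<delta>: "0 < \<delta>" "\<delta> < 1"
    and B: "B = 1 + sqrt (4 * ln (real n * D / \<delta>)) + 2 * ln (real n * D / \<delta>)"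
    and D_ge: "12 / \<epsilon>\<^sup>2 * ln (3 * real n / \<delta>) * B\<^sup>2 \<le> D"
  shows "0 < B"
    and "D * exp (2 - B) + exp (- (D * \<epsilon>\<^sup>2 / 64)) + exp (- (D * \<epsilon>\<^sup>2 * (1 / (8 * B) - 1 / (16 * B\<^sup>2))))
      \<le> \<delta> / (real n)\<^sup>2"
proof -
  define L where "L = ln (real n * D / \<delta>)"
  define l where "l = ln (3 * real n / \<delta>)"
  have nD: "2 \<le> real n * D"
    using mult_mono[of 2 "real n" 1 D] n D by simp
  then have "2 \<le> real n * D / \<delta>"
    using \<delta> mult_mono[of 2 "real n * D" \<delta> 1] by (simp add: le_divide_eq)
  then have "ln 2 \<le> L"
    unfolding L_def by (intro ln_mono) auto
  then have L: "2 / 3 \<le> L"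
    using ln2_ge_two_thirds by linarith
  \<comment> \<open>Since 64/25 < 8/3, this gives \<open>B\<close> \<ge> 1 + 8/5 + 4/3 >
    39/10.\<close>
  have "(8 / 5)\<^sup>2 \<le> 4 * L"
    using L by (simp add: power2_eq_square)
  then have sqrt_L: "8 / 5 \<le> sqrt (4 * L)"
    by (rule real_le_rsqrt)
  have B_ge: "39 / 10 \<le> B"
    using B L sqrt_L unfolding L_def[symmetric] by linarith
  then show "0 < B" by simp
  have "3 * real n / \<delta> \<ge> 1"
    using n \<delta> by (simp add: le_divide_eq)
  then have l: "0 \<le> l" by (simp add: l_def)
  have D': "12 * l * B\<^sup>2 \<le> D * \<epsilon>\<^sup>2"
    using D_ge \<epsilon> by (simp add: l_def field_simps)
  \<comment> \<open>Both Chernoff exponents are shown to be at least \<open>2 * l\<close> in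
    absolute value; doubling \<open>l\<close> is what produces the square of
    \<open>n\<close>.\<close>
  have exp_l: "exp (- (2 * l)) \<le> \<delta> / (9 * (real n)\<^sup>2)"
  proof -
    have "exp (- (2 * l)) = (\<delta> / (3 * real n))\<^sup>2"
      using n \<delta> by (simp add: l_def exp_minus exp_double power_divide)
    also have "\<dots> = \<delta> * \<delta> / (9 * (real n)\<^sup>2)"
      by (simp add: power2_eq_square)
    also have "\<dots> \<le> \<delta> * 1 / (9 * (real n)\<^sup>2)"
      using \<delta> by (intro divide_right_mono mult_left_mono) auto
    finally show ?thesis by simp
  qed
  have "D * exp (2 - B) \<le> 5 / 8 * (\<delta> / (real n)\<^sup>2)"
  proof -
    have "exp (3 / 5 :: real) \<ge> 8 / 5"
      using exp_ge_add_one_self[of "3 / 5 :: real"] by simp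
    then have "exp (- (3 / 5) :: real) \<le> 5 / 8"
      by (simp add: exp_minus field_simps)
    then have e: "exp (1 - sqrt (4 * L)) \<le> 5 / 8"
      using sqrt_L order_trans[of "exp (1 - sqrt (4 * L))" "exp (- (3 / 5))" "5 / 8"] by simp
    \<comment> \<open>The term \<open>2 * L\<close> supplies (\<delta> / (n D))^2, which absorbs the
      union over \<open>D\<close> rows, while the square root pays for the remaining
      constant.\<close>
    have "2 - B = (1 - sqrt (4 * L)) - 2 * L"
      using B by (simp add: L_def)
    then have "exp (2 - B) = exp (1 - sqrt (4 * L)) * exp (- (2 * L))"
      by (simp add: mult_exp_exp)
    also have "exp (- (2 * L)) = (\<delta> / (real n * D))\<^sup>2"
      using n \<delta> D by (simp add: L_def exp_minus exp_double power_divide)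
    finally have "D * exp (2 - B) = exp (1 - sqrt (4 * L)) * (\<delta> * (\<delta> / D) / (real n)\<^sup>2)"
      using D by (simp add: power2_eq_square field_simps)
    also have "\<dots> \<le> 5 / 8 * (\<delta> * 1 / (real n)\<^sup>2)"
      using e \<delta> D by (intro mult_mono divide_right_mono mult_left_mono) (auto simp: divide_le_eq)
    finally show ?thesis by simp
  qed
  moreover have "exp (- (D * \<epsilon>\<^sup>2 / 64)) \<le> \<delta> / (9 * (real n)\<^sup>2)"
  proof -
    have "(39 / 10)\<^sup>2 \<le> B\<^sup>2"
      using B_ge by (intro power_mono) auto
    then have "12 * l * (39 / 10)\<^sup>2 \<le> 12 * l * B\<^sup>2"
      using l by (intro mult_left_mono) auto
    \<comment> \<open>Numerically, 12 * 15.21 = 182.52 exceeds 128.\<close>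
    moreover have "64 * (2 * l) \<le> 12 * l * (39 / 10)\<^sup>2"
      using l by (simp add: power2_eq_square)
    ultimately have "2 * l \<le> D * \<epsilon>\<^sup>2 / 64"
      using D' by linarith
    then show ?thesis
      using order_trans[OF _ exp_l, of "exp (- (D * \<epsilon>\<^sup>2 / 64))"] by simp
  qed
  moreover have "exp (- (D * \<epsilon>\<^sup>2 * (1 / (8 * B) - 1 / (16 * B\<^sup>2)))) \<le> \<delta> / (9 * (real n)\<^sup>2)"
  proof -
    have eq: "1 / (8 * B) - 1 / (16 * B\<^sup>2) = (2 * B - 1) / (16 * B\<^sup>2)"
      using B_ge by (simp add: power2_eq_square field_simps)
    have "4 * l \<le> (2 * B - 1) * l"
      using B_ge l by (intro mult_right_mono) auto
    then have "2 * l \<le> 12 * l * ((2 * B - 1) / 16)"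
      using l by (simp add: field_simps)
    also have "\<dots> = 12 * l * B\<^sup>2 * ((2 * B - 1) / (16 * B\<^sup>2))"
      using B_ge by simp
    also have "\<dots> \<le> D * \<epsilon>\<^sup>2 * ((2 * B - 1) / (16 * B\<^sup>2))"
      using D' B_ge by (intro mult_right_mono) auto
    finally show ?thesis
      unfolding eq using order_trans[OF _ exp_l, of "exp (- (D * \<epsilon>\<^sup>2 * ((2 * B - 1) / (16 * B\<^sup>2))))"] by simp
  qed
  moreover have "5 / 8 * (\<delta> / (real n)\<^sup>2) + \<delta> / (9 * (real n)\<^sup>2) + \<delta> / (9 * (real n)\<^sup>2) \<le> \<delta> / (real n)\<^sup>2"
    using n \<delta> by (simp add: field_simps)
  ultimately show "D * exp (2 - B) + exp (- (D * \<epsilon>\<^sup>2 / 64))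
      + exp (- (D * \<epsilon>\<^sup>2 * (1 / (8 * B) - 1 / (16 * B\<^sup>2)))) \<le> \<delta> / (real n)\<^sup>2"
    by linarith
qed

section \<open>Distortion of a single difference vector\<close>

lemma power2_norm_vec: "(norm (v :: real ^ 'n))\<^sup>2 = (\<Sum>k\<in>UNIV. (v $ k)\<^sup>2)"
  unfolding power2_norm_eq_inner inner_vec_def by (simp add: power2_eq_square)

text \<open>The squared norm of \<open>A \<omega> *v v\<close>, divided by that of \<open>v\<close>,
  is the average of the squared row values, so the window for that average implies both distortion
  inequalities.\<close>

lemma (in sparse_projection) prob_norm_distortion:
  fixes A :: "'a \<Rightarrow> real ^ 'p ^ 'd" and v :: "real ^ 'p"
  assumes A: "\<And>\<omega> i k. \<omega> \<in> space M \<Longrightarrow>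
      A \<omega> $ i $ k = 1 / sqrt (real CARD('d) * q) * \<zeta> \<omega> $ i $ k * U \<omega> $ i $ k"
    and v: "v \<noteq> 0" "c = (1 / (sqrt q * norm v)) *\<^sub>R v"
    and \<epsilon>: "0 < \<epsilon>" "\<epsilon> < 1" and B: "0 < B"
  shows "prob {\<omega> \<in> space M. \<not> ((1 - \<epsilon>) * (norm (A \<omega> *v v))\<^sup>2 \<le> (norm v)\<^sup>2 \<and>
      (norm v)\<^sup>2 \<le> (1 + \<epsilon>) * (norm (A \<omega> *v v))\<^sup>2)}
    \<le> real CARD('d) * exp (2 - B) + exp (- (real CARD('d) * \<epsilon>\<^sup>2 / 64))
      + exp (- (real CARD('d) * \<epsilon>\<^sup>2 * (1 / (8 * B) - 1 / (16 * B\<^sup>2))))"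
proof (rule order_trans[OF finite_measure_mono prob_sum_row_value_deviation[OF \<epsilon> B]])
  let ?d = "real CARD('d)"
  let ?S = "\<lambda>\<omega>. \<Sum>i\<in>UNIV. (row_value (\<zeta> \<omega> $ i) (U \<omega> $ i))\<^sup>2"
  have q: "q > 0"
    using c_normalised q_range by (cases "q = 0") auto
  have norm_eq: "(norm (A \<omega> *v v))\<^sup>2 = (norm v)\<^sup>2 * (?S \<omega> / ?d)" if "\<omega> \<in> space M" for \<omega>
  proof -
    have entry: "A \<omega> $ i $ k * v $ k = norm v / sqrt ?d * (\<zeta> \<omega> $ i $ k * c $ k * U \<omega> $ i $ k)" for i k
      using A[OF that] v q by (simp add: real_sqrt_mult field_simps)
    have "(A \<omega> *v v) $ i = norm v / sqrt ?d * row_value (\<zeta> \<omega> $ i) (U \<omega> $ i)" for i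
      by (simp add: matrix_vector_mult_def row_value_def entry sum_distrib_left)
    then show ?thesis
      unfolding power2_norm_vec[of "A \<omega> *v v"]
      by (simp add: power_mult_distrib power_divide sum_distrib_left[symmetric] sum_divide_distrib[symmetric])
  qed
  have distortion: "(1 - \<epsilon>) * (norm (A \<omega> *v v))\<^sup>2 \<le> (norm v)\<^sup>2 \<and> (norm v)\<^sup>2 \<le> (1 + \<epsilon>) * (norm (A \<omega> *v v))\<^sup>2"
    if \<omega>: "\<omega> \<in> space M" and S: "?d * (1 - \<epsilon> / 2) \<le> ?S \<omega>" "?S \<omega> \<le> ?d * (1 + \<epsilon>)" for \<omega>
  proof -
    let ?r = "?S \<omega> / ?d"
    have r: "1 - \<epsilon> / 2 \<le> ?r" "?r \<le> 1 + \<epsilon>"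
      using S by (simp_all add: field_simps)
    have "(1 - \<epsilon>) * ?r \<le> (1 - \<epsilon>) * (1 + \<epsilon>)"
      using \<epsilon> r by (intro mult_left_mono) auto
    also have "\<dots> = 1 - \<epsilon>\<^sup>2"
      by (simp add: power2_eq_square algebra_simps)
    also have "\<dots> \<le> 1" by simp
    finally have "(norm v)\<^sup>2 * ((1 - \<epsilon>) * ?r) \<le> (norm v)\<^sup>2 * 1"
      by (intro mult_left_mono) auto
    then have up: "(1 - \<epsilon>) * (norm (A \<omega> *v v))\<^sup>2 \<le> (norm v)\<^sup>2"
      unfolding norm_eq[OF \<omega>] by (simp add: mult.left_commute)
    \<comment> \<open>Here the halved lower margin matters: (1 + \<epsilon>) (1 - \<epsilon>/2) = 1
      + (\<epsilon> - \<epsilon>^2) / 2, which is at least 1.\<close>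
    have "\<epsilon> * \<epsilon> \<le> \<epsilon> * 1"
      using \<epsilon> by (intro mult_left_mono) auto
    then have "1 \<le> (1 + \<epsilon>) * (1 - \<epsilon> / 2)"
      by (simp add: algebra_simps)
    also have "\<dots> \<le> (1 + \<epsilon>) * ?r"
      using \<epsilon> r by (intro mult_left_mono) auto
    finally have "(norm v)\<^sup>2 * 1 \<le> (norm v)\<^sup>2 * ((1 + \<epsilon>) * ?r)"
      by (intro mult_left_mono) auto
    then have low: "(norm v)\<^sup>2 \<le> (1 + \<epsilon>) * (norm (A \<omega> *v v))\<^sup>2"
      unfolding norm_eq[OF \<omega>] by (simp add: mult.left_commute)
    from up low show ?thesis by blast
  qed
  show "{\<omega> \<in> space M. \<not> ((1 - \<epsilon>) * (norm (A \<omega> *v v))\<^sup>2 \<le> (norm v)\<^sup>2 \<and>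
      (norm v)\<^sup>2 \<le> (1 + \<epsilon>) * (norm (A \<omega> *v v))\<^sup>2)}
    \<subseteq> {\<omega> \<in> space M. \<not> (?d * (1 - \<epsilon> / 2) \<le> ?S \<omega> \<and> ?S \<omega> \<le> ?d * (1 + \<epsilon>))}"
    using distortion by blast
qed measurable

section \<open>From one pair to all pairs\<close>

text \<open>Every squared coordinate of \<open>v\<close> is at most the squared maximum norm, hence
  at most \<open>q * (norm v)\<^sup>2\<close>; dividing by this quantity yields the bound on the
  entries of \<open>c\<close>. A nonzero \<open>v\<close> forces \<open>q\<close> to be
  positive.\<close>

lemma (in prob_space) sparse_projectionI:
  fixes U \<zeta> :: "'a \<Rightarrow> real ^ 'p ^ 'd" and v :: "real ^ 'p"
  assumes "iid_entries M U" "\<And>i k. sub_gaussian1 M (\<lambda>\<omega>. U \<omega> $ i $ k)"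
    and "\<And>i k. variance (\<lambda>\<omega>. U \<omega> $ i $ k) = 1"
    and "iid_entries M \<zeta>" and \<zeta>: "\<And>i k. bernoulli_rv M q (\<lambda>\<omega>. \<zeta> \<omega> $ i $ k)"
    and "indep_var borel \<zeta> borel U"
    and v: "v \<noteq> 0" and q: "(infnorm v)\<^sup>2 / (norm v)\<^sup>2 \<le> q"
  shows "sparse_projection M U \<zeta> q ((1 / (sqrt q * norm v)) *\<^sub>R v)"
proof -
  have "0 < (infnorm v)\<^sup>2 / (norm v)\<^sup>2"
    using v by (simp add: infnorm_eq_0)
  with q have q_pos: "0 < q" by linarith
  have c_sq: "(((1 / (sqrt q * norm v)) *\<^sub>R v) $ k)\<^sup>2 = (v $ k)\<^sup>2 / (q * (norm v)\<^sup>2)" for k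
    using q_pos by (simp add: power_divide power_mult_distrib)
  show ?thesis
  proof unfold_locales
    fix k
    have "(v $ k)\<^sup>2 \<le> (infnorm v)\<^sup>2"
      using component_le_infnorm_cart[of v k] by (simp add: abs_le_square_iff[symmetric] infnorm_pos_le)
    also have "\<dots> \<le> q * (norm v)\<^sup>2"
      using q v by (simp add: divide_le_eq)
    finally show "(((1 / (sqrt q * norm v)) *\<^sub>R v) $ k)\<^sup>2 \<le> 1"
      unfolding c_sq using q_pos v by (simp add: divide_le_eq)
  next
    show "q * (\<Sum>k\<in>UNIV. (((1 / (sqrt q * norm v)) *\<^sub>R v) $ k)\<^sup>2) = 1"
      unfolding c_sq sum_divide_distrib[symmetric] power2_norm_vec[symmetric] using q_pos v by simp
  qed (use assms in \<open>auto simp: iid_entries_def sub_gaussian1_iff\<close>)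
qed

theorem theorem3:
  fixes M :: "'a measure"
    and U \<zeta> A :: "'a \<Rightarrow> real ^ 'p ^ 'd"
    and x :: "nat \<Rightarrow> real ^ 'p"
    and n :: nat
    and q \<epsilon> \<delta> :: real
  assumes "prob_space M"
    and "iid_entries M U"
    and "\<And>i k. sub_gaussian1 M (\<lambda>\<omega>. U \<omega> $ i $ k)"
    and "\<And>i k. prob_space.variance M (\<lambda>\<omega>. U \<omega> $ i $ k) = 1"
    and "iid_entries M \<zeta>"
    and "\<And>i k. bernoulli_rv M q (\<lambda>\<omega>. \<zeta> \<omega> $ i $ k)"
    and "prob_space.indep_var M borel \<zeta> borel U"
    and "\<And>\<omega> i k. \<omega> \<in> space M \<Longrightarrow>
           A \<omega> $ i $ k = 1 / sqrt (real CARD('d) * q) * \<zeta> \<omega> $ i $ k * U \<omega> $ i $ k"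
    and "\<And>i j. i \<in> {1..n} \<Longrightarrow> j \<in> {1..n} \<Longrightarrow> x i \<noteq> x j \<Longrightarrow>
           q \<ge> (infnorm (x i - x j))\<^sup>2 / (norm (x i - x j))\<^sup>2"
    and "0 < \<epsilon>" and "\<epsilon> < 1"
    and "0 < \<delta>" and "\<delta> < 1"
    and "real CARD('d) \<ge> 12 / \<epsilon>\<^sup>2 * ln (3 * real n / \<delta>) *
           (1 + sqrt (4 * ln (real n * real CARD('d) / \<delta>))
              + 2 * ln (real n * real CARD('d) / \<delta>))\<^sup>2"
  shows "measure M {\<omega> \<in> space M. \<forall>i\<in>{1..n}. \<forall>j\<in>{1..n}.
           (1 - \<epsilon>) * (norm (A \<omega> *v x i - A \<omega> *v x j))\<^sup>2 \<le> (norm (x i - x j))\<^sup>2 \<and>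
           (norm (x i - x j))\<^sup>2 \<le> (1 + \<epsilon>) * (norm (A \<omega> *v x i - A \<omega> *v x j))\<^sup>2} \<ge> 1 - \<delta>"
proof -
  interpret prob_space M by fact
  let ?d = "real CARD('d)"
  define B where "B = 1 + sqrt (4 * ln (real n * ?d / \<delta>)) + 2 * ln (real n * ?d / \<delta>)"
  \<comment> \<open>The event is phrased for \<open>A \<omega>\<close> applied to a difference, so
    that the bound for a single vector fits; linearity restores the original form at the
    end.\<close>
  define good where "good i j \<omega> \<longleftrightarrow>
      (1 - \<epsilon>) * (norm (A \<omega> *v (x i - x j)))\<^sup>2 \<le> (norm (x i - x j))\<^sup>2 \<and>
      (norm (x i - x j))\<^sup>2 \<le> (1 + \<epsilon>) * (norm (A \<omega> *v (x i - x j)))\<^sup>2" for i j \<omega>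
  let ?bad = "\<lambda>i j. {\<omega> \<in> space M. \<not> good i j \<omega>}"
  have [measurable]: "U \<in> borel_measurable M" "\<zeta> \<in> borel_measurable M"
    using assms(7) by (auto dest: indep_var_rv1 indep_var_rv2)
  \<comment> \<open>\<open>A\<close> is known only pointwise on the space, so measurability is read
    off from a polynomial in the entries of \<zeta> and \<open>U\<close>.\<close>
  have A_measurable: "(\<lambda>\<omega>. (norm (A \<omega> *v v))\<^sup>2) \<in> borel_measurable M" for v
  proof -
    have "(norm (A \<omega> *v v))\<^sup>2
        = (\<Sum>i\<in>UNIV. (\<Sum>k\<in>UNIV. 1 / sqrt (?d * q) * \<zeta> \<omega> $ i $ k * U \<omega> $ i $ k * v $ k)\<^sup>2)"
      if "\<omega> \<in> space M" for \<omega>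
      using assms(8)[OF that]
      by (simp add: power2_norm_vec matrix_vector_mult_def)
    then show ?thesis
      by (subst measurable_cong) auto
  qed
  have good_sets [measurable]: "{\<omega> \<in> space M. good i j \<omega>} \<in> events" for i j
    unfolding good_def using A_measurable[measurable] by measurable
  have bad_le: "prob (?bad i j) \<le> \<delta> / (real n)\<^sup>2" if ij: "i \<in> {1..n}" "j \<in> {1..n}" for i j
  \<comment> \<open>For equal points both inequalities read 0 \<le> 0. Otherwise the indices differ,
    which provides \<open>2 \<le> n\<close>.\<close>
  proof (cases "x i = x j")
    case True
    then show ?thesis using assms(12) by (simp add: good_def)
  next
    case False
    then have "i \<noteq> j" by auto
    with ij have n: "2 \<le> n" by auto
    have d: "1 \<le> ?d" by (simp add: Suc_leI)
    note num = failure_probability_le[OF n d assms(10,12,13) B_def, folded B_def]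
    have D_ge: "12 / \<epsilon>\<^sup>2 * ln (3 * real n / \<delta>) * B\<^sup>2 \<le> ?d"
      using assms(14) by (simp add: B_def)
    interpret sparse_projection M U \<zeta> q "(1 / (sqrt q * norm (x i - x j))) *\<^sub>R (x i - x j)"
      using False by (intro sparse_projectionI assms(2-7) assms(9) ij) auto
    show ?thesis
      unfolding good_def
      using False num[OF D_ge] assms(10,11)
      by (intro order_trans[OF prob_norm_distortion[OF assms(8)]]) auto
  qed
  let ?I = "{1..n} \<times> {1..n}"
  have "prob (\<Union>p\<in>?I. case p of (i, j) \<Rightarrow> ?bad i j) \<le> (\<Sum>p\<in>?I. prob (case p of (i, j) \<Rightarrow> ?bad i j))"
    by (intro finite_measure_subadditive_finite) auto
  also have "\<dots> \<le> real (card ?I) * (\<delta> / (real n)\<^sup>2)"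
    using bad_le by (intro sum_bounded_above) auto
  \<comment> \<open>There are n^2 ordered pairs, each costing \<delta> / n^2; for
    \<open>n = 0\<close> the index set is empty and the bound is 0.\<close>
  also have "\<dots> \<le> \<delta>"
    using assms(12) by (simp add: power2_eq_square)
  finally have "prob (\<Union>p\<in>?I. case p of (i, j) \<Rightarrow> ?bad i j) \<le> \<delta>" .
  moreover have "{\<omega> \<in> space M. \<forall>i\<in>{1..n}. \<forall>j\<in>{1..n}. good i j \<omega>}
      = space M - (\<Union>p\<in>?I. case p of (i, j) \<Rightarrow> ?bad i j)"
    by auto
  moreover have "prob (space M - (\<Union>p\<in>?I. case p of (i, j) \<Rightarrow> ?bad i j))
      = 1 - prob (\<Union>p\<in>?I. case p of (i, j) \<Rightarrow> ?bad i j)"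
    by (intro prob_compl sets.finite_UN) auto
  ultimately show ?thesis
    by (simp add: good_def matrix_vector_mult_diff_distrib)
qed

end
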